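(* Let $n$ be a positive integer. Let $\tilde{w}=w+nr\in\tilde{\mathfrak{S}}(n)$ be an affine permutation, where $w\in\mathfrak{S}(n)$ is a finite permutation and $r=(r(1),\dots,r(n))\in Q$ is an element of the root lattice. Let $j\in\{1,\dots,n\}$ be the largest index such that the value $r(j)$ is a minimum (i.e. $r(j)=\min_{1\le i\le n} r(i)$). Then $$\mathrm{ish}^{-1}(\tilde{w})=j+n\,(-r(j)-1).$$
   Context: $\tilde{\mathfrak{S}}(n)$ is the group (under composition) of bijections $\tilde{w}:\mathbb{Z}\to\mathbb{Z}$ with $\tilde{w}(k+n)=\tilde{w}(k)+n$ for all $k\in\mathbb{Z}$ and $\tilde{w}(1)+\cdots+\tilde{w}(n)=\binom{n+1}{2}$; its elements are called affine permutations, and $\tilde{w}$ is determined by its window $[\tilde{w}(1),\dots,\tilde{w}(n)]$. The root lattice is $Q=\{(r(1),\dots,r(n))\in\mathbb{Z}^n: r(1)+\cdots+r(n)=0\}$. Each affine permutation has a unique expression $\tilde{w}=w+nr$ with $w\in\mathfrak{S}(n)$ and $r\in Q$, meaning $\tilde{w}(i)=w(i)+n\,r(i)$ for $1\le i\le n$. For integers $i<j$ with $i\not\equiv j\pmod n$, $((i,j))$ denotes the affine transposition swapping $i+kn$ and $j+kn$ for all $k\in\mathbb{Z}$. For $1\le i\le n$, $i<j$, it is an affine inversion of $\tilde{w}$ if $\tilde{w}(i)>\tilde{w}(j)$. For $\tilde{w}\in\tilde{\mathfrak{S}}(n)$ let $\tilde{w}^I\in\tilde{\mathfrak{S}}(n)$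 be the affine permutation whose window $[\tilde{w}^I(1),\dots,\tilde{w}^I(n)]$ is the increasing rearrangement of $[\tilde{w}(1),\dots,\tilde{w}(n)]$. The statistic $\mathrm{ish}(\tilde{w})$ is the number of affine inversions of $\tilde{w}^I$ of the form $((n,j))$, i.e. the number of integers $j>n$ with $\tilde{w}^I(n)>\tilde{w}^I(j)$. The inverse statistic is $\mathrm{ish}^{-1}(\tilde{w}):=\mathrm{ish}(\tilde{w}^{-1})$. *)

theory Defs
  imports Complex_Main "HOL-Number_Theory.Cong" "HOL-Combinatorics.Permutations" "HOL-Library.FuncSet"
begin

definition affine_perms :: "nat \<Rightarrow> (int \<Rightarrow> int) set" where
  "affine_perms n = {f. bij f \<and> (\<forall>k. f (k + int n) = f k + int n) \<and>
     (\<Sum>i = 1..int n. f i) = int ((n + 1) choose 2)}"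

text \<open>Vectors in \<open>\<int>\<^sup>n\<close> are functions on the index set \<open>{1..n}\<close>, \<open>undefined\<close> elsewhere.\<close>

definition root_lattice :: "nat \<Rightarrow> (int \<Rightarrow> int) set" where
  "root_lattice n = {r \<in> {1..int n} \<rightarrow>\<^sub>E UNIV. (\<Sum>i = 1..int n. r i) = 0}"

definition window :: "nat \<Rightarrow> (int \<Rightarrow> int) \<Rightarrow> int list" where
  "window n f = map f [1..int n]"

text \<open>The map with \<open>f (k + n) = f k + n\<close> for all \<open>k\<close> whose window is the list \<open>xs\<close> of length \<open>n\<close>.\<close>

definition of_window :: "nat \<Rightarrow> int list \<Rightarrow> int \<Rightarrow> int" where
  "of_window n xs k = xs ! nat ((k - 1) mod int n) + int n * ((k - 1) div int n)"

definition sorted_rep :: "nat \<Rightarrow> (int \<Rightarrow> int) \<Rightarrow> int \<Rightarrow> int" where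
  "sorted_rep n f = of_window n (sort (window n f))"

text \<open>The pair \<open>(i, j)\<close> stands for the affine transposition \<open>((i, j))\<close> that swaps \<open>i + k n\<close> and
  \<open>j + k n\<close> for all \<open>k\<close>. Under the conditions \<open>1 \<le> i \<le> n\<close> and \<open>i < j\<close>, distinct pairs give
  distinct transpositions, so counting pairs is counting transpositions.\<close>

definition affine_inversions :: "nat \<Rightarrow> (int \<Rightarrow> int) \<Rightarrow> (int \<times> int) set" where
  "affine_inversions n f =
     {(i, j). 1 \<le> i \<and> i \<le> int n \<and> i < j \<and> \<not> [i = j] (mod int n) \<and> f i > f j}"

definition ish :: "nat \<Rightarrow> (int \<Rightarrow> int) \<Rightarrow> nat" where
  "ish n f = card {j. (int n, j) \<in> affine_inversions n (sorted_rep n f)}"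

definition ish_inv :: "nat \<Rightarrow> (int \<Rightarrow> int) \<Rightarrow> nat" where
  "ish_inv n f = ish n (inv f)"

lemma window_of_window:
  assumes "length xs = n"
  shows "window n (of_window n xs) = xs"
  using assms by (auto simp: window_def of_window_def intro!: nth_equalityI)

lemma window_sorted_rep: "window n (sorted_rep n f) = sort (window n f)"
  unfolding sorted_rep_def by (rule window_of_window) (simp add: window_def)

lemma of_window_shift:
  assumes "n > 0"
  shows "of_window n xs (k + int n) = of_window n xs k + int n"
proof -
  have eq: "k + int n - 1 = (k - 1) + int n" by simp
  have "(k + int n - 1) mod int n = (k - 1) mod int n"
    unfolding eq by (rule mod_add_self2)
  moreover have "(k + int n - 1) div int n = (k - 1) div int n + 1"
    unfolding eq using assms by (intro div_add_self2) simp
  ultimately show ?thesis by (simp add: of_window_def distrib_left)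
qed

end

theory Submission
  imports Defs
begin

text \<open>
  Only the window of the inverse enters the statistic, and only as a multiset. The positions
  beyond the \<open>n\<close>-th are \<open>p + n t\<close> with \<open>1 \<le> p \<le> n\<close> and \<open>t \<ge> 1\<close>, and there an
  affine map takes the value of its window at \<open>p\<close> raised by \<open>n t\<close>. Sorting the window puts its
  maximum \<open>M\<close> at position \<open>n\<close>, so a window entry \<open>x\<close> contributes one inversion for each
  \<open>t \<ge> 1\<close> with \<open>x + n t < M\<close>. This turns \<open>ish\<close> into a sum over window entries
  (lemma \<open>ish_eq_sum\<close>), which does not see the order of the window.

  If \<open>f i = w i + n r i\<close>, the inverse sends \<open>w i\<close> to \<open>i - n r i\<close>, so these numbers are
  the window entries of the inverse. As \<open>i\<close> varies by less than \<open>n\<close>, the largest of them is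
  the one with the least \<open>r i\<close> and, among those, the largest \<open>i\<close>; it is \<open>M = j - n r j\<close>. The
  entry with index \<open>i\<close> then contributes \<open>r i - r j\<close> inversions if \<open>i \<le> j\<close>, and one fewer if
  \<open>i > j\<close>. Because \<open>r\<close> sums to zero, the total is \<open>- n r j - (n - j)\<close>.
\<close>

lemma shift_multiple:
  fixes f :: "int \<Rightarrow> int" and N :: int
  assumes "\<And>k. f (k + N) = f k + N"
  shows "f (k + N * m) = f k + N * m"
proof (induction m rule: int_induct[where k = 0])
  case base
  show ?case by simp
next
  case (step1 m)
  with assms[of "k + N * m"] show ?case by (simp add: algebra_simps)
next
  case (step2 m)
  with assms[of "k + N * (m - 1)"] show ?case by (simp add: algebra_simps)
qed

lemma le_zdiv_iff:
  fixes t a N :: int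
  assumes "N > 0"
  shows "t \<le> a div N \<longleftrightarrow> t * N \<le> a"
proof
  assume "t \<le> a div N"
  then have "t * N \<le> a div N * N" using assms by (intro mult_right_mono) auto
  also have "\<dots> \<le> a" using pos_mod_sign[OF assms, of a] by (simp add: minus_mod_eq_div_mult[symmetric])
  finally show "t * N \<le> a" .
next
  assume "t * N \<le> a"
  then have "t * N div N \<le> a div N" using assms by (intro zdiv_mono1)
  then show "t \<le> a div N" using assms by simp
qed

lemma sorted_rep_shift_multiple:
  assumes "n > 0"
  shows "sorted_rep n f (k + int n * m) = sorted_rep n f k + int n * m"
  unfolding sorted_rep_def by (rule shift_multiple) (rule of_window_shift[OF assms])

lemma length_window: "length (window n f) = n"
  by (simp add: window_def)

lemma set_window: "set (window n f) = f ` {1..int n}"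
  by (simp add: window_def)

lemma sum_list_window:
  fixes c :: "int \<Rightarrow> 'a::comm_monoid_add"
  shows "sum_list (map c (window n f)) = (\<Sum>i = 1..int n. c (f i))"
  by (simp add: window_def comp_def sum_list_distinct_conv_sum_set)

text \<open>A symmetric function of the window cannot tell it from its sorted version.\<close>

lemma sum_sorted_rep:
  fixes c :: "int \<Rightarrow> 'a::comm_monoid_add"
  shows "(\<Sum>i = 1..int n. c (sorted_rep n f i)) = (\<Sum>i = 1..int n. c (f i))"
proof -
  have "sum_list (map c (sort (window n f))) = sum_list (map c (window n f))"
    by (metis mset_map mset_sort sum_mset_sum_list)
  then show ?thesis
    by (simp add: window_sorted_rep[symmetric] sum_list_window)
qed

lemma sorted_rep_last:
  assumes "n > 0"
  shows "sorted_rep n f (int n) = Max (f ` {1..int n})"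
proof -
  let ?xs = "sort (window n f)"
  have len: "length ?xs = n" by (simp add: length_window)
  have "(int n - 1) mod int n = int n - 1" and "(int n - 1) div int n = 0"
    using assms by (auto intro!: mod_pos_pos_trivial div_pos_pos_trivial simp del: minus_mod_self1)
  then have "sorted_rep n f (int n) = ?xs ! nat (int n - 1)"
    by (simp add: sorted_rep_def of_window_def)
  also have "nat (int n - 1) = n - 1" by simp
  also have "?xs ! (n - 1) = Max (set ?xs)"
  proof (rule Max_eqI[symmetric])
    fix y assume "y \<in> set ?xs"
    then obtain p where "p < n" and "y = ?xs ! p"
      by (metis in_set_conv_nth len)
    then show "y \<le> ?xs ! (n - 1)"
      using len by (auto intro!: sorted_nth_mono)
  next
    show "?xs ! (n - 1) \<in> set ?xs" using assms len by (intro nth_mem) simp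
  qed simp
  finally show ?thesis by (simp add: set_window)
qed

text \<open>
  Each position beyond the first \<open>n\<close> is \<open>p + n t\<close> for exactly one \<open>p\<close> in the window and one
  \<open>t \<ge> 1\<close>; the summand is the number of admissible \<open>t\<close> for a given window entry. For the
  maximal entry the quotient is \<open>-1\<close>, which \<open>nat\<close> turns into the correct count \<open>0\<close>.
\<close>

lemma ish_eq_sum:
  assumes "n > 0"
  shows "ish n f = (\<Sum>i = 1..int n. nat ((Max (f ` {1..int n}) - f i - 1) div int n))"
proof -
  define N where "N = int n"
  define s where "s = sorted_rep n f"
  define M where "M = Max (f ` {1..N})"
  define T where "T = (\<lambda>x. {1..(M - x - 1) div N})"
  have N: "N > 0" using assms by (simp add: N_def)
  have shift: "s (k + N * m) = s k + N * m" for k m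
    using sorted_rep_shift_multiple[OF assms] by (simp add: s_def N_def)
  have sN: "s N = M"
    using sorted_rep_last[OF assms] by (simp add: s_def M_def N_def)
  have T: "t \<in> T x \<longleftrightarrow> 1 \<le> t \<and> x + N * t < M" for t x
  proof -
    have "t \<le> (M - x - 1) div N \<longleftrightarrow> t * N \<le> M - x - 1"
      using N by (simp only: le_zdiv_iff)
    also have "\<dots> \<longleftrightarrow> x + N * t < M" by (auto simp: mult.commute)
    finally show ?thesis by (simp add: T_def)
  qed
  \<comment> \<open>At \<open>n + n m\<close> with \<open>m \<ge> 1\<close> the value is \<open>M + n m\<close>, above \<open>M\<close>.\<close>
  have cong: "\<not> [N = k] (mod N)" if "N < k" "s k < M" for k
  proof
    assume "[N = k] (mod N)"
    then obtain m where k: "k = N + N * m" by (metis cong_iff_lin)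
    with \<open>N < k\<close> N have "N * m > 0" by simp
    with \<open>s k < M\<close> shift[of N m] k sN show False by simp
  qed
  have positions: "{k. (N, k) \<in> affine_inversions n s} = {k. N < k \<and> s k < M}"
    using cong N sN by (auto simp: affine_inversions_def N_def)
  have image: "(\<lambda>(p, t). p + N * t) ` (SIGMA p:{1..N}. T (s p)) = {k. N < k \<and> s k < M}"
  proof (intro equalityI subsetI)
    fix k assume "k \<in> (\<lambda>(p, t). p + N * t) ` (SIGMA p:{1..N}. T (s p))"
    then obtain p t where k: "k = p + N * t" and p: "1 \<le> p" and t: "t \<in> T (s p)" by auto
    have "N * 1 \<le> N * t" using t T N by (intro mult_left_mono) auto
    then show "k \<in> {k. N < k \<and> s k < M}" using k p t T shift by auto
  next
    fix k assume k: "k \<in> {k. N < k \<and> s k < M}"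
    define p where "p = (k - 1) mod N + 1"
    define t where "t = (k - 1) div N"
    have eq: "k = p + N * t" by (simp add: p_def t_def)
    have p: "p \<in> {1..N}"
      using pos_mod_bound[OF N, of "k - 1"] pos_mod_sign[OF N, of "k - 1"]
      unfolding p_def atLeastAtMost_iff by linarith
    have "1 * N \<le> k - 1" using k by simp
    then have "1 \<le> t" unfolding t_def using N by (simp only: le_zdiv_iff)
    then have "t \<in> T (s p)" using k T shift eq by auto
    then show "k \<in> (\<lambda>(p, t). p + N * t) ` (SIGMA p:{1..N}. T (s p))"
      using p eq by force
  qed
  have "inj_on (\<lambda>(p, t). p + N * t) (SIGMA p:{1..N}. T (s p))"
  proof (rule inj_onI, clarify)
    have quot: "(p + N * t - 1) div N = t" if "p \<in> {1..N}" for p t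
      using that by (intro int_div_pos_eq[where r = "p - 1"]) auto
    fix p t p' t'
    assume "p \<in> {1..N}" "p' \<in> {1..N}" and eq: "p + N * t = p' + N * t'"
    then have "t = t'" using quot[of p t] quot[of p' t'] by simp
    with eq show "p = p' \<and> t = t'" by simp
  qed
  from card_image[OF this] have "ish n f = card (SIGMA p:{1..N}. T (s p))"
    unfolding ish_def image N_def[symmetric] s_def[symmetric] positions .
  also have "\<dots> = (\<Sum>p = 1..N. card (T (s p)))"
    by (simp add: T_def)
  also have "\<dots> = (\<Sum>p = 1..N. card (T (f p)))"
    unfolding s_def N_def by (rule sum_sorted_rep)
  finally show ?thesis by (simp add: T_def M_def N_def)
qed

lemma inv_affine_apply:
  assumes "f \<in> affine_perms n" and "f i = a + int n * b"
  shows "inv f a = i - int n * b"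
proof -
  have f: "bij f" and "\<And>k. f (k + int n) = f k + int n"
    using assms(1) by (auto simp: affine_perms_def)
  then have "f (i + int n * (- b)) = f i + int n * (- b)"
    by (intro shift_multiple)
  then have "f (i - int n * b) = a" using assms(2) by simp
  then show ?thesis using f by (metis bij_inv_eq_iff)
qed

text \<open>
  Maximising \<open>i - n r i\<close> is lexicographic: decreasing \<open>r i\<close> by one gains \<open>n\<close>, more than
  any change of \<open>i\<close> can lose.
\<close>

lemma Max_diff_mult:
  fixes r :: "int \<Rightarrow> int"
  assumes "j \<in> {1..N}"
    and min: "\<And>i. i \<in> {1..N} \<Longrightarrow> r j \<le> r i"
    and last: "\<And>i. i \<in> {1..N} \<Longrightarrow> j < i \<Longrightarrow> r j < r i"
  shows "Max ((\<lambda>i. i - N * r i) ` {1..N}) = j - N * r j"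
proof (rule Max_eqI)
  fix y assume "y \<in> (\<lambda>i. i - N * r i) ` {1..N}"
  then obtain i where i: "i \<in> {1..N}" and y: "y = i - N * r i" by auto
  show "y \<le> j - N * r j"
  proof (cases "j < i")
    case True
    then have "N * 1 \<le> N * (r i - r j)"
      using i last[OF i] by (intro mult_left_mono) auto
    then show ?thesis using y i assms(1) by (simp add: algebra_simps)
  next
    case False
    have "N * r j \<le> N * r i" using i min[OF i] by (intro mult_left_mono) auto
    then show ?thesis using y False by simp
  qed
qed (use assms(1) in auto)

theorem theorem10:
  fixes n :: nat and f w r :: "int \<Rightarrow> int" and j :: int
  assumes "n > 0"
    and "f \<in> affine_perms n"
    and "w permutes {1..int n}"
    and "r \<in> root_lattice n"
    and "\<forall>i\<in>{1..int n}. f i = w i + int n * r i"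
    and "j = Max {i \<in> {1..int n}. r i = Min (r ` {1..int n})}"
  shows "int (ish_inv n f) = j + int n * (- r j - 1)"
proof -
  define N where "N = int n"
  define g where "g = inv f"
  define J where "J = {i \<in> {1..N}. r i = Min (r ` {1..N})}"
  have N: "N > 0" using assms(1) by (simp add: N_def)
  have "Min (r ` {1..N}) \<in> r ` {1..N}" using N by (intro Min_in) auto
  then have "J \<noteq> {}" by (auto simp: J_def)
  moreover have "finite J"
    by (rule finite_subset[of _ "{1..N}"]) (auto simp: J_def)
  ultimately have "j \<in> J" and J_le: "\<And>i. i \<in> J \<Longrightarrow> i \<le> j"
    using assms(6) Max_in[of J] Max_ge[of J] by (simp_all add: J_def N_def)
  then have j: "j \<in> {1..N}" and rj: "r j = Min (r ` {1..N})" by (auto simp: J_def)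
  have min: "r j \<le> r i" if "i \<in> {1..N}" for i
    using that by (simp add: rj)
  have last: "r j < r i" if "i \<in> {1..N}" "j < i" for i
  proof -
    have "i \<notin> J" using J_le[of i] that(2) by auto
    then have "r i \<noteq> r j" using that(1) rj by (simp add: J_def)
    then show ?thesis using min[OF that(1)] by simp
  qed
  have gw: "g (w i) = i - N * r i" if "i \<in> {1..N}" for i
    using inv_affine_apply[OF assms(2)] assms(5) that by (simp add: g_def N_def)
  have "g ` {1..N} = (\<lambda>i. i - N * r i) ` {1..N}"
  proof -
    have "g ` {1..N} = g ` w ` {1..N}" using permutes_image[OF assms(3)] by (simp add: N_def)
    also have "\<dots> = (\<lambda>i. i - N * r i) ` {1..N}"
      unfolding image_image by (rule image_cong[OF refl gw])
    finally show ?thesis .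
  qed
  then have Max_g: "Max (g ` {1..N}) = j - N * r j"
    using Max_diff_mult[where r = r, OF j min last] by simp
  have summand: "int (nat ((j - N * r j - g (w i) - 1) div N))
      = r i - r j - (if j < i then 1 else 0)"
    if i: "i \<in> {1..N}" for i
  proof -
    have num: "j - N * r j - g (w i) - 1 = N * (r i - r j) + (j - i - 1)"
      using gw[OF i] by (simp add: algebra_simps)
    \<comment> \<open>The remainder \<open>j - i - 1\<close> lies between \<open>-n\<close> and \<open>n - 2\<close>; if negative, it borrows one \<open>n\<close>.\<close>
    have quot: "(j - N * r j - g (w i) - 1) div N = r i - r j - (if i < j then 0 else 1)"
    proof (cases "i < j")
      case True
      with num i j show ?thesis
        by (intro int_div_pos_eq[where r = "j - i - 1"]) auto
    next
      case False
      with num i j show ?thesis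
        by (intro int_div_pos_eq[where r = "j - i - 1 + N"]) (auto simp: algebra_simps)
    qed
    show ?thesis
      using quot min[OF i] last[OF i] by (cases i j rule: linorder_cases) auto
  qed
  have "int (ish_inv n f) = (\<Sum>p = 1..N. int (nat ((j - N * r j - g p - 1) div N)))"
    using ish_eq_sum[OF assms(1), of g] Max_g by (simp add: ish_inv_def g_def N_def)
  also have "\<dots> = (\<Sum>i = 1..N. int (nat ((j - N * r j - g (w i) - 1) div N)))"
    using sum.permute[OF assms(3)] by (simp add: N_def comp_def)
  also have "\<dots> = (\<Sum>i = 1..N. r i - r j - (if j < i then 1 else 0))"
    by (intro sum.cong summand) auto
  also have "\<dots> = (\<Sum>i = 1..N. r i) - N * r j - (\<Sum>i = 1..N. if j < i then 1 else 0)"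
    using N by (simp add: sum_subtractf)
  also have "(\<Sum>i = 1..N. r i) = 0"
    using assms(4) by (simp add: root_lattice_def N_def)
  also have "(\<Sum>i = 1..N. if j < i then 1 else 0) = N - j"
  proof -
    have "{i \<in> {1..N}. j < i} = {j<..N}" using j by auto
    then have "(\<Sum>i = 1..N. if j < i then 1 else 0) = (\<Sum>i\<in>{j<..N}. 1::int)"
      by (simp add: sum.inter_filter[symmetric])
    then show ?thesis using j by simp
  qed
  finally show ?thesis by (simp add: N_def algebra_simps)
qed

end
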